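(* Let $\gamma>0$, $\epsilon>0$ and let $n_h,n_d,n_z\ge 1$ be integers. Let $\kappa_\gamma:\omega\mapsto(A,B,C,D)$ be the explicit map defined in the context, with free parameters $\omega=(\mu_1,\theta_1,\dots,\mu_{n_h},\theta_{n_h},\tilde D,\bar Y)$, where $\mu_j,\theta_j\in\mathbb{R}$, $\tilde D\in\mathbb{R}^{n_z\times n_d}$ and $\bar Y\in\mathbb{R}^{2n_h\times(n_d+n_z)}$ are arbitrary. Then $\kappa_\gamma$ is a free parametrization of $\mathcal{L}_2$-bounded LTI systems with bound $\gamma$. That is, for every value of $\omega$, with $(A,B,C,D)=\kappa_\gamma(\omega)$, the discrete-time LTI system $$h_{k+1}=Ah_k+Bd_k,\qquad z_k=Ch_k+Dd_k,\qquad h_0=0,\quad k\in\mathbb{N},$$ has $\mathcal{L}_2$-bound $\gamma$: there is a constant $\beta\ge 0$ such that for every square-summable input sequence $\mathbf{d}=(d_0,d_1,\dots)$ with $d_k\in\mathbb{R}^{n_d}$, the output sequence $\mathbf{z}=(z_0,z_1,\dots)$ is square-summable and $$\|\mathbf{z}\|_2\le\gamma\|\mathbf{d}\|_2+\beta .$$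
   Context: Notation. For a sequence $\mathbf{v}=(v_0,v_1,\dots)$ of vectors, $\|\mathbf{v}\|_2=\big(\sum_{k\ge0}\|v_k\|_2^2\big)^{1/2}$. For a matrix $M$, $\|M\|_2$ is the spectral norm (largest singular value), $M^\top$ is the transpose and $M^*$ is the conjugate transpose. $\odot$ is the entrywise (Hadamard) product. $\mathbb{1}_{a\times b}$ and $0_{a\times b}$ are the all-ones and all-zeros $a\times b$ matrices. $i$ is the imaginary unit. States and outputs of the system are allowed to be complex, since $A$ is complex. Definition of $\kappa_\gamma$. Given $\gamma>0$, a fixed constant $\epsilon>0$ and free parameters $\mu_j,\theta_j\in\mathbb{R}$ ($1\le j\le n_h$), $\tilde D\in\mathbb{R}^{n_z\times n_d}$, $\bar Y\in\mathbb{R}^{2n_h\times(n_d+n_z)}$, set: (1) $\lambda_j=\exp\!\big(-\exp(\mu_j)+i\exp(\theta_j)\big)$ and $A=\mathrm{diag}(\lambda_1,\dots,\lambda_{n_h})\in\mathbb{C}^{n_h\times n_h}$. (2) $D=\dfrac{\gamma}{\|\tilde D\|_2+\epsilon}\,\tilde D$. (3) $P=A^*A+\epsilon I_{n_h}$, $\quad W=\begin{bmatrix} P & PA \\ {A^*P} & P \end{bmatrix}$, $\quad Z=\begin{bmatrix} \gamma I_{n_d} & D^\top \\ {D} & \gamma I_{n_z} \end{bmatrix}$ (both $W$ and $Z$ are invertible). (4) $\tilde Y=\mathcal{M}\odot\bar Y$ with $\mathcal{M}=\begin{bmatrix} \mathbb{1}_{n_h\times n_d} & 0_{n_h\times n_z}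 \\ 0_{n_h\times n_d} & \mathbb{1}_{n_h\times n_z} \end{bmatrix}$. (5) $\eta=\max\{1,\ \|W^{-1}\tilde Y\|_2,\ \|Z^{-1}\tilde Y^\top\|_2\}$ and $Y=\eta^{-1}\tilde Y=\begin{bmatrix} Y_{11} & 0 \\ 0 & Y_{22} \end{bmatrix}$ with $Y_{11}\in\mathbb{R}^{n_h\times n_d}$, $Y_{22}\in\mathbb{R}^{n_h\times n_z}$. (6) $B=P^{-1}Y_{11}$ and $C=Y_{22}^\top$. Then $\kappa_\gamma(\omega)=(A,B,C,D)$. A function $\kappa$ from a space $\mathbb{R}^p$ of unconstrained parameters to quadruples $(A,B,C,D)$ is called a free parametrization of $\mathcal{L}_2$-bounded LTI systems with bound $\gamma$ if, for every $\omega\in\mathbb{R}^p$, the input/output map $\mathbf{d}\mapsto\mathbf{z}$ of the LTI system with matrices $\kappa(\omega)$ and zero initial state satisfies, for some constant $\beta\ge 0$, the $\mathcal{L}_2$-bound inequality $\|\mathbf{z}\|_2\le\gamma\|\mathbf{d}\|_2+\beta$ for all square-summable inputs $\mathbf{d}$. *)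

theory Defs
  imports "HOL-Analysis.Analysis"
begin

text \<open>
  Dimensions are finite index types. Vertical and horizontal stacking of blocks is rendered by
  sum types, so a \<open>2 n\<^sub>h \<times> (n\<^sub>d + n\<^sub>z)\<close> matrix has rows indexed by \<^typ>\<open>'h + 'h\<close>
  and columns indexed by \<^typ>\<open>'d + 'z\<close>. The type \<^typ>\<open>real^'n^'m\<close> has \<^typ>\<open>'m\<close> rows and
  \<^typ>\<open>'n\<close> columns.
\<close>

definition cvec :: "real^'n \<Rightarrow> complex^'n"
  where "cvec v = (\<chi> i. of_real (v $ i))"

definition cmat :: "real^'n^'m \<Rightarrow> complex^'n^'m"
  where "cmat M = (\<chi> i j. of_real (M $ i $ j))"

definition ctranspose :: "complex^'n^'m \<Rightarrow> complex^'m^'n"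
  where "ctranspose M = (\<chi> i j. cnj (M $ j $ i))"

definition diag :: "'a::zero^'n \<Rightarrow> 'a^'n^'n"
  where "diag v = (\<chi> i j. if i = j then v $ i else 0)"

definition block ::
  "'a^'n1^'m1 \<Rightarrow> 'a^'n2^'m1 \<Rightarrow> 'a^'n1^'m2 \<Rightarrow> 'a^'n2^'m2 \<Rightarrow> 'a^('n1::finite + 'n2::finite)^('m1::finite + 'm2::finite)"
  where "block K L M N = (\<chi> i j. case (i, j) of
      (Inl p, Inl q) \<Rightarrow> K $ p $ q
    | (Inl p, Inr q) \<Rightarrow> L $ p $ q
    | (Inr p, Inl q) \<Rightarrow> M $ p $ q
    | (Inr p, Inr q) \<Rightarrow> N $ p $ q)"

definition block11 :: "'a^('n1::finite + 'n2::finite)^('m1::finite + 'm2::finite) \<Rightarrow> 'a^'n1^'m1"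
  where "block11 M = (\<chi> i j. M $ Inl i $ Inl j)"

definition block22 :: "'a^('n1::finite + 'n2::finite)^('m1::finite + 'm2::finite) \<Rightarrow> 'a^'n2^'m2"
  where "block22 M = (\<chi> i j. M $ Inr i $ Inr j)"


definition singular_value :: "complex^'n^'m \<Rightarrow> real \<Rightarrow> bool"
  where "singular_value M s \<longleftrightarrow>
    s \<ge> 0 \<and> (\<exists>v. v \<noteq> 0 \<and> (ctranspose M ** M) *v v = (s^2) *\<^sub>R v)"

definition spectral_norm :: "complex^'n^'m \<Rightarrow> real"
  where "spectral_norm M = (GREATEST s. singular_value M s)"

text \<open>
  For a real matrix \<open>M\<close> the spectral norm is taken as \<open>spectral_norm (cmat M)\<close>, which has the
  same singular values.

  The library norm on \<^typ>\<open>complex^'n^'m\<close> is the Frobenius norm, not the spectral norm. The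
  following facts show that the greatest singular value exists and is the operator norm induced
  by the Euclidean norms.
\<close>

lemma inner_ctranspose:
  fixes M :: "complex^'n^'m"
  shows "inner (M *v w) u = inner w (ctranspose M *v u)"
proof -
  have e: "inner (a * x) y = inner x (cnj a * y)" for a x y :: complex
    by (simp add: inner_complex_def algebra_simps)
  have "inner (M *v w) u = (\<Sum>i\<in>UNIV. \<Sum>j\<in>UNIV. inner (M $ i $ j * w $ j) (u $ i))"
    by (simp add: inner_vec_def matrix_vector_mult_def inner_sum_left)
  also have "\<dots> = (\<Sum>j\<in>UNIV. \<Sum>i\<in>UNIV. inner (w $ j) (cnj (M $ i $ j) * u $ i))"
    by (subst sum.swap) (simp only: e)
  also have "\<dots> = inner w (ctranspose M *v u)"
    by (simp add: inner_vec_def matrix_vector_mult_def inner_sum_right ctranspose_def)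
  finally show ?thesis .
qed

lemma singular_value_le_onorm:
  fixes M :: "complex^'n^'m"
  assumes "singular_value M s"
  shows "s \<le> onorm ((*v) M)"
proof -
  obtain v where v: "v \<noteq> 0" "(ctranspose M ** M) *v v = (s^2) *\<^sub>R v" and s: "s \<ge> 0"
    using assms unfolding singular_value_def by blast
  have "(norm (M *v v))^2 = inner v ((s^2) *\<^sub>R v)"
    by (simp add: power2_norm_eq_inner inner_ctranspose matrix_vector_mul_assoc v(2))
  also have "\<dots> = (s * norm v)^2"
    by (simp add: power_mult_distrib power2_norm_eq_inner)
  finally have "norm (M *v v) = s * norm v"
    using s by (simp add: power2_eq_iff_nonneg)
  then have "s * norm v \<le> onorm ((*v) M) * norm v"
    using onorm[OF matrix_vector_mul_bounded_linear, of M v] by simp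
  then show ?thesis using v(1) by simp
qed

lemma singular_value_onorm:
  fixes M :: "complex^'n^'m"
  shows "singular_value M (onorm ((*v) M))"
proof -
  let ?f = "(*v) M"
  interpret f: bounded_linear ?f by (rule matrix_vector_mul_bounded_linear)
  have ne: "sphere (0 :: complex^'n) 1 \<noteq> {}"
    using vector_choose_size[of 1, where 'a = "complex^'n"] by auto
  have "continuous_on (sphere 0 1) (\<lambda>v. norm (?f v))"
    by (intro continuous_intros f.continuous_on)
  then obtain v where v: "norm v = 1" and
    vmax: "\<And>w. norm w = 1 \<Longrightarrow> norm (?f w) \<le> norm (?f v)"
    using continuous_attains_sup[OF compact_sphere ne] by fastforce
  define s where "s = norm (?f v)"
  have s0: "s \<ge> 0" by (simp add: s_def)
  have bnd: "norm (?f w) \<le> s * norm w" for w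
  proof (cases "w = 0")
    case False
    have "norm (?f (inverse (norm w) *\<^sub>R w)) \<le> s"
      unfolding s_def by (rule vmax) (use False in simp)
    then show ?thesis using False by (simp add: f.scaleR field_simps)
  qed (simp add: f.zero)
  have os: "onorm ?f = s"
  proof (rule antisym)
    show "onorm ?f \<le> s" by (rule onorm_le) (rule bnd)
    show "s \<le> onorm ?f"
      using onorm[OF matrix_vector_mul_bounded_linear, of M v] by (simp add: v s_def)
  qed
  define g where "g = (s^2) *\<^sub>R v - (ctranspose M ** M) *v v"
  have "inner g g = 0"
  proof (rule ccontr)
    assume g: "inner g g \<noteq> 0"
    define q where "q = s^2 * inner g g - inner (?f g) (?f g)"
    have ge: "2 * t * inner g g + t^2 * q \<ge> 0" for t
    proof -
      have "(norm (?f (v + t *\<^sub>R g)))^2 \<le> (s * norm (v + t *\<^sub>R g))^2"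
        by (intro power_mono bnd) simp
      moreover have "(norm (?f (v + t *\<^sub>R g)))^2
          = s^2 + 2 * t * inner g ((ctranspose M ** M) *v v) + t^2 * inner (?f g) (?f g)"
      proof -
        have "(norm (?f (v + t *\<^sub>R g)))^2
            = inner (?f v) (?f v) + 2 * t * inner (?f g) (?f v) + t^2 * inner (?f g) (?f g)"
          unfolding power2_norm_eq_inner
          by (simp add: f.add f.scaleR inner_left_distrib inner_right_distrib inner_commute
              power2_eq_square algebra_simps)
        then show ?thesis
          by (simp add: s_def power2_norm_eq_inner inner_ctranspose[of M g]
              matrix_vector_mul_assoc)
      qed
      moreover have "(s * norm (v + t *\<^sub>R g))^2
          = s^2 * (1 + 2 * t * inner g v + t^2 * inner g g)"
        using v unfolding power_mult_distrib power2_norm_eq_inner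
        by (simp add: norm_eq_1 inner_left_distrib inner_right_distrib inner_commute
            power2_eq_square algebra_simps)
      ultimately have "s^2 + 2 * t * inner g ((ctranspose M ** M) *v v) + t^2 * inner (?f g) (?f g)
          \<le> s^2 * (1 + 2 * t * inner g v + t^2 * inner g g)"
        by (simp only:)
      then have "0 \<le> 2 * t * (s^2 * inner g v - inner g ((ctranspose M ** M) *v v)) + t^2 * q"
        by (simp add: q_def algebra_simps)
      also have "s^2 * inner g v - inner g ((ctranspose M ** M) *v v) = inner g g"
        by (simp add: g_def inner_diff_right[of "_ - _"])
      finally show ?thesis .
    qed
    have pos: "inner g g > 0" using g inner_ge_zero[of g] by linarith
    define t where "t = - inner g g / (1 + \<bar>q\<bar>)"
    have "t * (2 * inner g g + t * q) \<ge> 0"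
      using ge[of t] by (simp add: algebra_simps power2_eq_square)
    moreover have "t < 0" using pos by (simp add: t_def divide_neg_pos)
    ultimately have "2 * inner g g + t * q \<le> 0"
      by (simp add: zero_le_mult_iff)
    moreover have "\<bar>t * q\<bar> \<le> inner g g"
    proof -
      have "\<bar>t * q\<bar> = inner g g * (\<bar>q\<bar> / (1 + \<bar>q\<bar>))"
        using pos by (simp add: t_def abs_mult abs_divide)
      also have "\<dots> \<le> inner g g * 1"
        using pos by (intro mult_left_mono) auto
      finally show ?thesis by simp
    qed
    ultimately show False using pos by linarith
  qed
  then have "(ctranspose M ** M) *v v = (s^2) *\<^sub>R v" by (simp add: g_def)
  moreover have "v \<noteq> 0" using v by auto
  ultimately show ?thesis using s0 os unfolding singular_value_def by auto
qed

lemma spectral_norm_eq_onorm: "spectral_norm M = onorm ((*v) M)"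
  unfolding spectral_norm_def
  by (rule Greatest_equality) (auto intro: singular_value_onorm singular_value_le_onorm)


type_synonym ('h, 'd, 'z) lti =
  "(complex^'h^'h) \<times> (complex^'d^'h) \<times> (complex^'h^'z) \<times> (complex^'d^'z)"

primrec lti_state :: "('h::finite, 'd::finite, 'z::finite) lti \<Rightarrow> (nat \<Rightarrow> real^'d) \<Rightarrow> nat \<Rightarrow> complex^'h"
  where
    "lti_state S d 0 = 0"
  | "lti_state S d (Suc k) = (case S of (A, B, C, D) \<Rightarrow>
       A *v lti_state S d k + B *v cvec (d k))"

definition lti_output :: "('h::finite, 'd::finite, 'z::finite) lti \<Rightarrow> (nat \<Rightarrow> real^'d) \<Rightarrow> nat \<Rightarrow> complex^'z"
  where "lti_output S d k = (case S of (A, B, C, D) \<Rightarrow>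
    C *v lti_state S d k + D *v cvec (d k))"

definition square_summable :: "(nat \<Rightarrow> 'a::real_normed_vector) \<Rightarrow> bool"
  where "square_summable v \<longleftrightarrow> summable (\<lambda>k. (norm (v k))^2)"

definition l2_norm :: "(nat \<Rightarrow> 'a::real_normed_vector) \<Rightarrow> real"
  where "l2_norm v = sqrt (\<Sum>k. (norm (v k))^2)"

definition l2_bounded :: "real \<Rightarrow> ('h::finite, 'd::finite, 'z::finite) lti \<Rightarrow> bool"
  where "l2_bounded \<gamma> S \<longleftrightarrow> (\<exists>\<beta>\<ge>0. \<forall>d. square_summable d \<longrightarrow>
    square_summable (lti_output S d) \<and> l2_norm (lti_output S d) \<le> \<gamma> * l2_norm d + \<beta>)"

text \<open>The parameter space \<open>\<real>\<^sup>p\<close> is any Euclidean space, so that a product of vector and matrix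
  spaces can be used without flattening.\<close>

definition free_parametrization ::
  "real \<Rightarrow> ('p::euclidean_space \<Rightarrow> ('h::finite, 'd::finite, 'z::finite) lti) \<Rightarrow> bool"
  where "free_parametrization \<gamma> \<kappa> \<longleftrightarrow> (\<forall>\<omega>. l2_bounded \<gamma> (\<kappa> \<omega>))"


definition kappa_A :: "real^'h \<Rightarrow> real^'h \<Rightarrow> complex^'h^'h"
  where "kappa_A \<mu> \<theta> =
    diag (\<chi> j. exp (- of_real (exp (\<mu> $ j)) + \<i> * of_real (exp (\<theta> $ j))))"

definition kappa_D :: "real \<Rightarrow> real \<Rightarrow> real^'d^'z \<Rightarrow> real^'d^'z"
  where "kappa_D \<gamma> \<epsilon> Dt = (\<gamma> / (spectral_norm (cmat Dt) + \<epsilon>)) *\<^sub>R Dt"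

definition kappa_P :: "real \<Rightarrow> complex^'h^'h \<Rightarrow> complex^'h^'h"
  where "kappa_P \<epsilon> A = ctranspose A ** A + \<epsilon> *\<^sub>R mat 1"

definition kappa_W :: "real \<Rightarrow> complex^'h^'h \<Rightarrow> complex^('h::finite + 'h::finite)^('h::finite + 'h::finite)"
  where "kappa_W \<epsilon> A =
    (let P = kappa_P \<epsilon> A in block P (P ** A) (ctranspose A ** P) P)"

definition kappa_Z :: "real \<Rightarrow> real^'d^'z \<Rightarrow> real^('d::finite + 'z::finite)^('d::finite + 'z::finite)"
  where "kappa_Z \<gamma> D = block (\<gamma> *\<^sub>R mat 1) (transpose D) D (\<gamma> *\<^sub>R mat 1)"

text \<open>On the vector types, \<open>*\<close> is entrywise (the Hadamard product on matrices) and \<open>1\<close> is the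
  all-ones vector or matrix; the matrix product and identity are \<open>**\<close> and \<open>mat 1\<close>.\<close>

definition kappa_Yt :: "real^('d::finite + 'z::finite)^('h::finite + 'h::finite) \<Rightarrow> real^('d::finite + 'z::finite)^('h::finite + 'h::finite)"
  where "kappa_Yt Ybar = block 1 0 0 1 * Ybar"

definition kappa_eta ::
  "complex^('h::finite + 'h::finite)^('h::finite + 'h::finite) \<Rightarrow> real^('d::finite + 'z::finite)^('d::finite + 'z::finite) \<Rightarrow> real^('d::finite + 'z::finite)^('h::finite + 'h::finite) \<Rightarrow> real"
  where "kappa_eta W Z Yt = Max {1,
    spectral_norm (matrix_inv W ** cmat Yt),
    spectral_norm (cmat (matrix_inv Z ** transpose Yt))}"

definition kappa ::
  "real \<Rightarrow> real \<Rightarrow> (real^'h) \<times> (real^'h) \<times> (real^'d^'z) \<times> (real^('d::finite + 'z::finite)^('h::finite + 'h::finite))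
    \<Rightarrow> ('h::finite, 'd::finite, 'z::finite) lti"
  where "kappa \<gamma> \<epsilon> \<omega> = (case \<omega> of (\<mu>, \<theta>, Dt, Ybar) \<Rightarrow>
    let A = kappa_A \<mu> \<theta>;
        D = kappa_D \<gamma> \<epsilon> Dt;
        Yt = kappa_Yt Ybar;
        \<eta> = kappa_eta (kappa_W \<epsilon> A) (kappa_Z \<gamma> D) Yt;
        Y = inverse \<eta> *\<^sub>R Yt;
        B = matrix_inv (kappa_P \<epsilon> A) ** cmat (block11 Y);
        C = cmat (transpose (block22 Y))
    in (A, B, C, cmat D))"

end

theory Submission imports Defs
begin

text \<open>
  Both \<open>W\<close> and \<open>Z\<close> are positive definite: \<open>|\<lambda>\<^sub>j| < 1\<close> makes \<open>P - A\<^sup>* P A\<close> positive, and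
  \<open>D\<close> has norm below \<open>\<gamma>\<close>. The scaling by \<open>\<eta>\<close> makes \<open>W\<^sup>-\<^sup>1 Y\<close> and \<open>Z\<^sup>-\<^sup>1 Y\<^sup>T\<close> contractions. Hence
  \<open>K = Z\<^sup>-\<^sup>1 Y\<^sup>T W\<^sup>-\<^sup>1 Y\<close> is a contraction that is self-adjoint for the inner product of \<open>Z\<close>, so its
  \<open>Z\<close>-form is at most \<open>Z\<close>, and the Hermitian matrix with blocks \<open>W\<close>, \<open>Y\<close>, \<open>Y\<^sup>T\<close>, \<open>Z\<close> is positive
  semidefinite. This is the bounded real lemma inequality with storage function \<open>h\<^sup>* P h\<close>; summing
  it along a trajectory gives the bound, with \<open>\<beta> = 0\<close>.
\<close>

section \<open>Positivity of block forms with contractive off-diagonal factors\<close>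

text \<open>With \<open>a\<^sub>n = \<langle>y, Z K\<^sup>n y\<rangle>\<close>, positivity of \<open>Z\<close> at \<open>y - K\<^sup>m y\<close> gives \<open>2 a\<^sub>m \<le> a\<^sub>0 + a\<^sub>2\<^sub>m\<close>. A positive
  gap \<open>a\<^sub>1 - a\<^sub>0\<close> would therefore double forever, although \<open>a\<close> is bounded.\<close>

lemma symmetric_contraction_form_le:
  fixes Z K :: "'a::real_inner \<Rightarrow> 'a"
  assumes Z: "bounded_linear Z"
    and Zsym: "\<And>x y. inner x (Z y) = inner (Z x) y"
    and Zpos: "\<And>x. 0 \<le> inner x (Z x)"
    and Ksym: "\<And>x y. inner x (Z (K y)) = inner (K x) (Z y)"
    and Kle: "\<And>x. norm (K x) \<le> norm x"
  shows "inner y (Z (K y)) \<le> inner y (Z y)"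
proof (rule ccontr)
  interpret Z: bounded_linear Z by (rule Z)
  define a where "a n = inner y (Z ((K ^^ n) y))" for n
  assume "\<not> ?thesis"
  then have gap: "0 < a 1 - a 0" by (simp add: a_def)
  have pow_sym: "inner u (Z ((K ^^ n) v)) = inner ((K ^^ n) u) (Z v)" for n u v
  proof (induction n arbitrary: u)
    case (Suc n)
    show ?case by (simp add: Ksym Suc.IH) (simp add: funpow_swap1)
  qed simp
  have pow_le: "norm ((K ^^ n) y) \<le> norm y" for n
    by (induction n) (auto intro: order_trans[OF Kle])
  have double: "2 * a m \<le> a 0 + a (2 * m)" for m
  proof -
    let ?u = "(K ^^ m) y"
    have "0 \<le> inner (y - ?u) (Z (y - ?u))" by (rule Zpos)
    also have "\<dots> = inner y (Z y) - 2 * inner y (Z ?u) + inner ?u (Z ?u)"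
      using Zsym[of ?u y]
      by (simp add: Z.diff inner_diff_left inner_diff_right inner_commute)
    \<comment> \<open>Self-adjointness moves all \<open>m\<close> factors of \<open>K\<close> from
      the left argument to the right one.\<close>
    also have "inner ?u (Z ?u) = a (2 * m)"
      unfolding a_def by (simp add: mult_2 funpow_add pow_sym[symmetric])
    finally show ?thesis by (simp add: a_def)
  qed
  \<comment> \<open>Since \<open>double\<close> reads
    \<open>2 * (a m - a 0) \<le> a (2 * m) - a 0\<close>, the gap at least doubles along powers of
    two.\<close>
  have grow: "2 ^ n * (a 1 - a 0) \<le> a (2 ^ n) - a 0" for n
  proof (induction n)
    case (Suc n)
    then show ?case using double[of "2 ^ n"] by simp
  qed simp
  obtain B where B: "\<And>x. norm (Z x) \<le> norm x * B" and "B \<ge> 0"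
    using Z.nonneg_bounded by blast
  have bdd: "a n \<le> norm y * (norm y * B)" for n
  proof -
    have "a n \<le> norm y * norm (Z ((K ^^ n) y))"
      unfolding a_def by (rule norm_cauchy_schwarz)
    also have "\<dots> \<le> norm y * (norm ((K ^^ n) y) * B)"
      by (intro mult_left_mono B norm_ge_zero)
    also have "\<dots> \<le> norm y * (norm y * B)"
      using \<open>B \<ge> 0\<close> by (intro mult_left_mono mult_right_mono pow_le) auto
    finally show ?thesis .
  qed
  obtain n where n: "(norm y * (norm y * B) - a 0) / (a 1 - a 0) < 2 ^ n"
    using real_arch_pow[of 2] by auto
  then have "norm y * (norm y * B) - a 0 < 2 ^ n * (a 1 - a 0)"
    using gap by (simp add: pos_divide_less_eq)
  with grow[of n] bdd[of "2 ^ n"] show False by linarith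
qed

text \<open>\<open>S\<close> and \<open>T\<close> stand for the contractions \<open>W^-1 Y\<close>
  and \<open>Z^-1 Y'\<close>. Completing the square in \<open>x\<close> leaves the
  \<open>Z\<close>-form of \<open>y\<close> minus the \<open>W\<close>-form of \<open>S y\<close>,
  and the latter is the \<open>Z\<close>-form of the composition of \<open>T\<close> and
  \<open>S\<close>.\<close>

lemma block_form_nonneg:
  fixes W :: "'a::real_inner \<Rightarrow> 'a" and Z :: "'b::real_inner \<Rightarrow> 'b"
    and Y :: "'b \<Rightarrow> 'a" and Y' :: "'a \<Rightarrow> 'b"
  assumes W: "linear W" and Z: "bounded_linear Z"
    and Wsym: "\<And>x y. inner x (W y) = inner (W x) y"
    and Wpos: "\<And>x. 0 \<le> inner x (W x)"
    and Zsym: "\<And>x y. inner x (Z y) = inner (Z x) y"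
    and Zpos: "\<And>x. 0 \<le> inner x (Z x)"
    and adj: "\<And>x y. inner x (Y y) = inner (Y' x) y"
    and S: "\<And>y. W (S y) = Y y" "\<And>y. norm (S y) \<le> norm y"
    and T: "\<And>x. Z (T x) = Y' x" "\<And>x. norm (T x) \<le> norm x"
  shows "0 \<le> inner x (W x) + 2 * inner x (Y y) + inner y (Z y)"
proof -
  \<comment> \<open>Both sides equal \<open>inner (Y u) (S v)\<close>. The right side is symmetric
    in \<open>u\<close> and \<open>v\<close>, which makes \<open>T (S v)\<close> self-adjoint for
    the \<open>Z\<close>-form.\<close>
  have TS: "inner u (Z (T (S v))) = inner (S u) (W (S v))" for u v
    using adj[of "S v" u] by (metis S(1) T(1) Wsym inner_commute)
  have "inner y (Z (T (S y))) \<le> inner y (Z y)"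
  proof (rule symmetric_contraction_form_le[OF Z Zsym Zpos])
    show "inner u (Z (T (S v))) = inner (T (S u)) (Z v)" for u v
      by (metis TS Wsym Zsym inner_commute)
    show "norm (T (S u)) \<le> norm u" for u
      using S(2)[of u] T(2)[of "S u"] by linarith
  qed
  then have "inner (S y) (W (S y)) \<le> inner y (Z y)" by (simp add: TS)
  moreover have "0 \<le> inner (x + S y) (W (x + S y))" by (rule Wpos)
  moreover have "inner (x + S y) (W (x + S y))
      = inner x (W x) + 2 * inner x (Y y) + inner (S y) (W (S y))"
    using Wsym[of "S y" x]
    by (simp add: linear_add[OF W] inner_add_left inner_add_right S(1) inner_commute)
  ultimately show ?thesis by linarith
qed

section \<open>From a storage function to the gain bound\<close>

text \<open>\<open>V\<close> is a storage function for the supply rate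
  \<open>\<gamma> |d|^2 - |z|^2 / \<gamma>\<close>. The sum telescopes, and the zero initial state
  stores nothing, so \<open>0\<close> serves as the offset.\<close>

lemma l2_bounded_if_dissipative:
  fixes S :: "('h::finite, 'd::finite, 'z::finite) lti"
  assumes "\<gamma> > 0" and V: "\<And>h. 0 \<le> V h" "V 0 = 0"
    and step: "\<And>d k. V (lti_state S d (Suc k)) + (norm (lti_output S d k))\<^sup>2 / \<gamma>
      \<le> V (lti_state S d k) + \<gamma> * (norm (d k))\<^sup>2"
  shows "l2_bounded \<gamma> S"
  unfolding l2_bounded_def
proof (intro exI[of _ 0] conjI allI impI)
  fix d :: "nat \<Rightarrow> real^'d"
  assume "square_summable d"
  then have d: "summable (\<lambda>k. (norm (d k))\<^sup>2)" by (simp add: square_summable_def)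
  let ?z = "lti_output S d"
  have telescope: "V (lti_state S d n) + (\<Sum>k<n. (norm (?z k))\<^sup>2) / \<gamma> \<le> \<gamma> * (\<Sum>k<n. (norm (d k))\<^sup>2)" for n
  proof (induction n)
    case (Suc n)
    then show ?case using step[of d n] by (simp add: distrib_left add_divide_distrib del: lti_state.simps)
  qed (simp add: V)
  have partial: "(\<Sum>k<n. (norm (?z k))\<^sup>2) \<le> \<gamma>\<^sup>2 * (\<Sum>k. (norm (d k))\<^sup>2)" for n
  proof -
    have "(\<Sum>k<n. (norm (?z k))\<^sup>2) / \<gamma> \<le> \<gamma> * (\<Sum>k<n. (norm (d k))\<^sup>2)"
      using telescope[of n] V(1)[of "lti_state S d n"] by linarith
    also have "\<dots> \<le> \<gamma> * (\<Sum>k. (norm (d k))\<^sup>2)"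
      using \<open>\<gamma> > 0\<close> d by (intro mult_left_mono sum_le_suminf) auto
    finally show ?thesis
      using \<open>\<gamma> > 0\<close> by (simp add: pos_divide_le_eq power2_eq_square mult_ac)
  qed
  have z: "summable (\<lambda>k. (norm (?z k))\<^sup>2)"
    by (rule summableI_nonneg_bounded[OF _ partial]) simp
  then show "square_summable ?z" by (simp add: square_summable_def)
  have "(\<Sum>k. (norm (?z k))\<^sup>2) \<le> \<gamma>\<^sup>2 * (\<Sum>k. (norm (d k))\<^sup>2)"
    by (rule suminf_le_const[OF z partial])
  then have "l2_norm ?z \<le> sqrt (\<gamma>\<^sup>2 * (\<Sum>k. (norm (d k))\<^sup>2))"
    unfolding l2_norm_def by (rule real_sqrt_le_mono)
  then show "l2_norm ?z \<le> \<gamma> * l2_norm d + 0"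
    using \<open>\<gamma> > 0\<close> by (simp add: l2_norm_def real_sqrt_mult)
qed simp

section \<open>Stacked vectors and block matrices\<close>

definition vjoin :: "'a^'m \<Rightarrow> 'a^'n \<Rightarrow> 'a^('m::finite + 'n::finite)"
  where "vjoin x y = (\<chi> i. case i of Inl p \<Rightarrow> x $ p | Inr q \<Rightarrow> y $ q)"

lemma vjoin_cases:
  obtains x y where "v = vjoin x y"
proof
  show "v = vjoin (\<chi> p. v $ Inl p) (\<chi> q. v $ Inr q)"
    by (simp add: vjoin_def vec_eq_iff split: sum.split)
qed

lemma sum_UNIV_Plus:
  fixes f :: "'m::finite + 'n::finite \<Rightarrow> 'a::comm_monoid_add"
  shows "sum f UNIV = (\<Sum>p\<in>UNIV. f (Inl p)) + (\<Sum>q\<in>UNIV. f (Inr q))"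
  by (subst UNIV_Plus_UNIV[symmetric], subst sum.Plus) auto

lemma inner_vjoin [simp]:
  "inner (vjoin x y) (vjoin u v) = inner x u + inner y v"
  by (simp add: inner_vec_def sum_UNIV_Plus vjoin_def)

lemma block_mult_vjoin [simp]:
  fixes K :: "'a::semiring_1^'n1^'m1" and N :: "'a^'n2^'m2"
  shows "block K L M N *v vjoin x y = vjoin (K *v x + L *v y) (M *v x + N *v y)"
  by (simp add: vec_eq_iff block_def vjoin_def matrix_vector_mult_def sum_UNIV_Plus split: sum.split)

lemma vjoin_eq_0_iff [simp]: "vjoin x y = (0 :: 'a::zero^('m::finite + 'n::finite)) \<longleftrightarrow> x = 0 \<and> y = 0"
  by (auto simp: vec_eq_iff vjoin_def split: sum.split)

lemma scaleR_matrix_vector: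
  fixes M :: "complex^'n^'m"
  shows "(c *\<^sub>R M) *v x = c *\<^sub>R (M *v x)"
  by (simp add: vec_eq_iff matrix_vector_mult_def scaleR_sum_right)

lemma matrix_vector_scaleR:
  fixes M :: "complex^'n^'m"
  shows "M *v (c *\<^sub>R x) = c *\<^sub>R (M *v x)"
  by (simp add: vec_eq_iff matrix_vector_mult_def scaleR_sum_right)

lemma matrix_vector_uminus:
  fixes M :: "complex^'n^'m"
  shows "M *v (- x) = - (M *v x)"
  using matrix_vector_scaleR[of M "-1" x] by simp

section \<open>Real matrices as complex ones, norms and inverses\<close>

lemma cmat_mult: "cmat (M ** N) = cmat M ** cmat N"
  by (simp add: cmat_def matrix_matrix_mult_def vec_eq_iff)

lemma cmat_mult_cvec: "cmat M *v cvec v = cvec (M *v v)"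
  by (simp add: cmat_def cvec_def matrix_vector_mult_def vec_eq_iff)

lemma cmat_0 [simp]: "cmat 0 = 0"
  by (simp add: cmat_def vec_eq_iff)

lemma cmat_mat_1 [simp]: "cmat (mat 1) = mat 1"
  by (simp add: cmat_def mat_def vec_eq_iff)

lemma cmat_scaleR: "cmat (c *\<^sub>R M) = c *\<^sub>R cmat M"
  by (simp add: cmat_def vec_eq_iff) (simp add: scaleR_conv_of_real)

lemma cmat_transpose: "cmat (transpose M) = ctranspose (cmat M)"
  by (simp add: cmat_def transpose_def ctranspose_def vec_eq_iff)

lemma cmat_block: "cmat (block K L M N) = block (cmat K) (cmat L) (cmat M) (cmat N)"
  by (simp add: cmat_def block_def vec_eq_iff split: sum.split)

lemma cvec_eq_0_iff [simp]: "cvec v = 0 \<longleftrightarrow> v = 0"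
  by (simp add: cvec_def vec_eq_iff)

lemma norm_cvec [simp]: "norm (cvec v) = norm v"
  by (simp add: cvec_def norm_vec_def L2_set_def)

lemma ctranspose_ctranspose [simp]: "ctranspose (ctranspose M) = M"
  by (simp add: ctranspose_def vec_eq_iff)

lemma norm_mult_le_spectral_norm: "norm (M *v v) \<le> spectral_norm M * norm v"
  unfolding spectral_norm_eq_onorm by (rule onorm[OF matrix_vector_mul_bounded_linear])

lemma spectral_norm_nonneg: "0 \<le> spectral_norm M"
  unfolding spectral_norm_eq_onorm by (rule onorm_pos_le[OF matrix_vector_mul_bounded_linear])

lemma matrix_inv_right_if_inj:
  fixes M :: "'a::field^'n^'n"
  assumes "\<And>x. M *v x = 0 \<Longrightarrow> x = 0"
  shows "M ** matrix_inv M = mat 1"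
proof -
  have "invertible M"
    using assms by (simp add: invertible_left_inverse matrix_left_invertible_ker)
  then show ?thesis
    unfolding invertible_def matrix_inv_def by (rule conjunct1[OF someI_ex])
qed

text \<open>On complex vectors \<open>inner\<close> is the real part of the Hermitian product; its
  positivity already excludes a kernel.\<close>

lemma matrix_inv_right_if_pos_def:
  fixes M :: "complex^'n^'n"
  assumes "\<And>x. x \<noteq> 0 \<Longrightarrow> 0 < inner x (M *v x)"
  shows "M ** matrix_inv M = mat 1"
  using assms by (intro matrix_inv_right_if_inj) force

section \<open>Symmetry and positivity of \<open>P\<close>, \<open>W\<close> and
  \<open>Z\<close>\<close>

lemma diag_mult: "diag l *v x = (\<chi> j. l $ j * x $ j)"
  for l :: "'a::semiring_1^'n"
  by (simp add: diag_def vec_eq_iff matrix_vector_mult_def if_distrib if_distribR sum.delta cong: if_cong)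

lemma kappa_P_mult: "kappa_P \<epsilon> A *v x = ctranspose A *v (A *v x) + \<epsilon> *\<^sub>R x"
  by (simp add: kappa_P_def matrix_vector_mult_add_rdistrib matrix_vector_mul_assoc scaleR_matrix_vector)

lemma kappa_P_symmetric: "inner x (kappa_P \<epsilon> A *v y) = inner (kappa_P \<epsilon> A *v x) y"
  using inner_ctranspose[of A x "A *v y"] inner_ctranspose[of A y "A *v x"]
  by (simp add: kappa_P_mult inner_add_left inner_add_right inner_commute)

lemma kappa_P_form: "inner x (kappa_P \<epsilon> A *v x) = (norm (A *v x))\<^sup>2 + \<epsilon> * (norm x)\<^sup>2"
  by (simp add: kappa_P_mult inner_add_right inner_ctranspose[symmetric] power2_norm_eq_inner)

lemma kappa_P_pos:
  assumes "\<epsilon> > 0" "x \<noteq> 0"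
  shows "0 < inner x (kappa_P \<epsilon> A *v x)"
  using assms by (simp add: kappa_P_form add_nonneg_pos)

lemma kappa_W_mult:
  "kappa_W \<epsilon> A *v vjoin x y = vjoin (kappa_P \<epsilon> A *v (x + A *v y))
    (ctranspose A *v (kappa_P \<epsilon> A *v x) + kappa_P \<epsilon> A *v y)"
  by (simp add: kappa_W_def Let_def matrix_vector_mul_assoc matrix_vector_right_distrib)

lemma kappa_W_symmetric: "inner x (kappa_W \<epsilon> A *v y) = inner (kappa_W \<epsilon> A *v x) y"
proof -
  obtain x1 x2 y1 y2 where [simp]: "x = vjoin x1 x2" "y = vjoin y1 y2"
    by (metis vjoin_cases)
  have "inner x2 (ctranspose A *v (kappa_P \<epsilon> A *v y1)) = inner (kappa_P \<epsilon> A *v (A *v x2)) y1"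
    by (simp add: inner_ctranspose[symmetric] kappa_P_symmetric)
  moreover have "inner (ctranspose A *v (kappa_P \<epsilon> A *v x1)) y2 = inner x1 (kappa_P \<epsilon> A *v (A *v y2))"
    by (metis inner_commute inner_ctranspose kappa_P_symmetric)
  ultimately show ?thesis
    by (simp add: kappa_W_mult inner_add_left inner_add_right matrix_vector_right_distrib
        kappa_P_symmetric)
qed

text \<open>Block completion of the square: \<open>W\<close> is \<open>[I A]^* P [I A]\<close> plus
  the Stein defect \<open>P - A^* P A\<close> in the lower diagonal block.\<close>

lemma kappa_W_form:
  "inner (vjoin x y) (kappa_W \<epsilon> A *v vjoin x y) = inner (x + A *v y) (kappa_P \<epsilon> A *v (x + A *v y))
    + (inner y (kappa_P \<epsilon> A *v y) - inner (A *v y) (kappa_P \<epsilon> A *v (A *v y)))"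
proof -
  have "inner y (ctranspose A *v (kappa_P \<epsilon> A *v x)) = inner (A *v y) (kappa_P \<epsilon> A *v x)"
    by (simp add: inner_ctranspose)
  then show ?thesis
    by (simp add: kappa_W_mult matrix_vector_right_distrib inner_add_left inner_add_right)
qed

text \<open>The Stein defect is positive because \<open>A\<close> shrinks both terms of the
  \<open>P\<close>-form \<open>|A y|^2 + \<epsilon> |y|^2\<close>. When \<open>y = 0\<close>,
  positivity of \<open>P\<close> at \<open>x\<close> takes over.\<close>

lemma kappa_W_pos:
  assumes "\<epsilon> > 0" and l: "\<And>j. cmod (l $ j) < 1" and "v \<noteq> 0"
  shows "0 < inner v (kappa_W \<epsilon> (diag l) *v v)"
proof -
  let ?A = "diag l" and ?P = "kappa_P \<epsilon> (diag l)"
  obtain x y where v: "v = vjoin x y" by (rule vjoin_cases)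
  have contr: "norm (?A *v u) < norm u" if "u \<noteq> 0" for u
  proof -
    \<comment> \<open>One nonzero coordinate shrinks strictly and no other grows.\<close>
    obtain j where "u $ j \<noteq> 0" using \<open>u \<noteq> 0\<close> unfolding vec_eq_iff zero_index by blast
    then have "cmod (l $ j * u $ j) < cmod (u $ j)" using l[of j] by (simp add: norm_mult)
    then have "(cmod (l $ j * u $ j))\<^sup>2 < (cmod (u $ j))\<^sup>2" by (simp add: power_strict_mono)
    moreover have "(cmod (l $ i * u $ i))\<^sup>2 \<le> (cmod (u $ i))\<^sup>2" for i
      using l[of i] by (intro power_mono) (auto simp: norm_mult less_imp_le intro: mult_left_le_one_le)
    ultimately have "(\<Sum>j\<in>UNIV. (cmod (l $ j * u $ j))\<^sup>2) < (\<Sum>j\<in>UNIV. (cmod (u $ j))\<^sup>2)"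
      by (intro sum_strict_mono_ex1) auto
    then show ?thesis
      by (simp add: diag_mult norm_vec_def L2_set_def)
  qed
  show ?thesis
  proof (cases "y = 0")
    case True
    with v \<open>v \<noteq> 0\<close> have "x \<noteq> 0" by simp
    with True show ?thesis
      unfolding v kappa_W_form using kappa_P_pos[OF \<open>\<epsilon> > 0\<close>] by simp
  next
    case False
    \<comment> \<open>Only weak, since \<open>?A *v y\<close> may vanish; strictness of the
      comparison comes from the \<open>\<epsilon>\<close> term.\<close>
    have "norm (?A *v (?A *v y)) \<le> norm (?A *v y)"
      using contr[of "?A *v y"] by (cases "?A *v y = 0") auto
    moreover have "norm (?A *v y) < norm y" using contr False by simp
    ultimately have "inner (?A *v y) (?P *v (?A *v y)) < inner y (?P *v y)"
      unfolding kappa_P_form using \<open>\<epsilon> > 0\<close>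
      by (intro add_le_less_mono mult_strict_left_mono power_mono power_strict_mono) auto
    moreover have "0 \<le> inner (x + ?A *v y) (?P *v (x + ?A *v y))"
      using \<open>\<epsilon> > 0\<close> by (simp add: kappa_P_form)
    ultimately show ?thesis unfolding v kappa_W_form by linarith
  qed
qed

lemma cmat_kappa_Z_mult:
  "cmat (kappa_Z \<gamma> D) *v vjoin x y
    = vjoin (\<gamma> *\<^sub>R x + ctranspose (cmat D) *v y) (cmat D *v x + \<gamma> *\<^sub>R y)"
  by (simp add: kappa_Z_def cmat_block cmat_scaleR cmat_transpose scaleR_matrix_vector)

lemma cmat_kappa_Z_symmetric:
  "inner x (cmat (kappa_Z \<gamma> D) *v y) = inner (cmat (kappa_Z \<gamma> D) *v x) y"
proof -
  obtain x1 x2 y1 y2 where [simp]: "x = vjoin x1 x2" "y = vjoin y1 y2"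
    by (metis vjoin_cases)
  have "inner (ctranspose (cmat D) *v x2) y1 = inner x2 (cmat D *v y1)"
    by (metis inner_commute inner_ctranspose)
  then show ?thesis
    by (simp add: cmat_kappa_Z_mult inner_add_left inner_add_right inner_ctranspose)
qed

lemma cmat_kappa_Z_form:
  "inner (vjoin x y) (cmat (kappa_Z \<gamma> D) *v vjoin x y)
    = \<gamma> * (norm x)\<^sup>2 + 2 * inner (cmat D *v x) y + \<gamma> * (norm y)\<^sup>2"
  by (simp add: cmat_kappa_Z_mult inner_add_right inner_ctranspose[symmetric]
      power2_norm_eq_inner inner_commute[of y "cmat D *v x"])

text \<open>The cross term is at most \<open>2 c |x| |y|\<close>, hence at most
  \<open>c (|x|^2 + |y|^2)\<close>, and the gap between \<open>c\<close> and \<open>\<gamma>\<close>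
  leaves a positive remainder.\<close>

lemma cmat_kappa_Z_pos:
  assumes D: "\<And>x. norm (cmat D *v x) \<le> c * norm x" and c: "0 \<le> c" "c < \<gamma>" and "v \<noteq> 0"
  shows "0 < inner v (cmat (kappa_Z \<gamma> D) *v v)"
proof -
  obtain x y where v: "v = vjoin x y" by (rule vjoin_cases)
  have "- inner (cmat D *v x) y \<le> norm (cmat D *v x) * norm y"
    using norm_cauchy_schwarz[of "cmat D *v x" "- y"] by simp
  also have "\<dots> \<le> c * norm x * norm y"
    by (intro mult_right_mono D) simp
  finally have "2 * - inner (cmat D *v x) y \<le> c * (2 * norm x * norm y)" by linarith
  also have "\<dots> \<le> c * ((norm x)\<^sup>2 + (norm y)\<^sup>2)"
    by (intro mult_left_mono c sum_squares_bound)
  also have "\<dots> < \<gamma> * ((norm x)\<^sup>2 + (norm y)\<^sup>2)"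
    using c \<open>v \<noteq> 0\<close> v by (intro mult_strict_right_mono) (auto simp: sum_power2_gt_zero_iff)
  finally show ?thesis unfolding v cmat_kappa_Z_form by (simp add: algebra_simps)
qed

text \<open>With \<open>s\<close> the spectral norm of \<open>Dt\<close>, the gain is
  \<open>\<gamma> s / (s + \<epsilon>)\<close>; the positive \<open>\<epsilon>\<close> keeps it
  strictly below \<open>\<gamma>\<close>, also for \<open>Dt = 0\<close>.\<close>

lemma kappa_D_bound:
  assumes "\<gamma> > 0" "\<epsilon> > 0"
  obtains c where "0 \<le> c" "c < \<gamma>" "\<And>x. norm (cmat (kappa_D \<gamma> \<epsilon> Dt) *v x) \<le> c * norm x"
proof
  let ?s = "spectral_norm (cmat Dt)"
  have s: "0 \<le> ?s" by (rule spectral_norm_nonneg)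
  show "0 \<le> \<gamma> / (?s + \<epsilon>) * ?s" using s assms by simp
  show "\<gamma> / (?s + \<epsilon>) * ?s < \<gamma>"
    using s assms by (simp add: divide_less_eq mult_strict_left_mono)
  show "norm (cmat (kappa_D \<gamma> \<epsilon> Dt) *v x) \<le> \<gamma> / (?s + \<epsilon>) * ?s * norm x" for x
  proof -
    have "norm (cmat (kappa_D \<gamma> \<epsilon> Dt) *v x) = \<gamma> / (?s + \<epsilon>) * norm (cmat Dt *v x)"
      using s assms by (simp add: kappa_D_def cmat_scaleR scaleR_matrix_vector)
    also have "\<dots> \<le> \<gamma> / (?s + \<epsilon>) * (?s * norm x)"
      using s assms by (intro mult_left_mono norm_mult_le_spectral_norm) auto
    finally show ?thesis by (simp add: mult_ac)
  qed
qed

section \<open>The dissipation inequality\<close>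

lemma kappa_Yt_block: "kappa_Yt Ybar = block (block11 Ybar) 0 0 (block22 Ybar)"
  by (simp add: kappa_Yt_def block_def block11_def block22_def vec_eq_iff split: sum.split)

text \<open>Schur complement of the matrix with blocks \<open>W\<close>, \<open>Y\<close>, \<open>Y\<^sup>T\<close>, \<open>Z\<close> along \<open>h\<^sub>k\<^sub>+\<^sub>1\<close> and \<open>z\<^sub>k\<close>:
  its quadratic form is evaluated at \<open>(- h\<^sub>k\<^sub>+\<^sub>1, h\<^sub>k, d\<^sub>k, - z\<^sub>k / \<gamma>)\<close>.\<close>

lemma dissipation:
  fixes h :: "complex^'h" and d :: "complex^'d" and D :: "real^'d^'z"
    and Y1 :: "real^'d^'h" and Y2 :: "real^'z^'h"
  assumes "\<gamma> > 0"
    and PB: "kappa_P \<epsilon> A ** B = cmat Y1"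
    and form: "\<And>x y. 0 \<le> inner x (kappa_W \<epsilon> A *v x) + 2 * inner x (cmat (block Y1 0 0 Y2) *v y)
      + inner y (cmat (kappa_Z \<gamma> D) *v y)"
    and h': "h' = A *v h + B *v d" and z: "z = cmat (transpose Y2) *v h + cmat D *v d"
  shows "inner h' (kappa_P \<epsilon> A *v h') + (norm z)\<^sup>2 / \<gamma> \<le> inner h (kappa_P \<epsilon> A *v h) + \<gamma> * (norm d)\<^sup>2"
proof -
  \<comment> \<open>The terms containing the last component \<open>w\<close> are
    \<open>2 * inner z w + \<gamma> |w|^2\<close>; they are least at
    \<open>w = - z / \<gamma>\<close>, with value \<open>- |z|^2 / \<gamma>\<close>.\<close>
  let ?P = "kappa_P \<epsilon> A" and ?w = "(- 1 / \<gamma>) *\<^sub>R z"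
  have B: "cmat Y1 *v d = ?P *v (h' - A *v h)"
    by (simp add: PB[symmetric] h' matrix_vector_mul_assoc)
  have C: "inner h (cmat Y2 *v z) = inner (z - cmat D *v d) z"
    by (simp add: z cmat_transpose inner_ctranspose)
  have "- h' + A *v h = - (h' - A *v h)" by simp
  then have W: "inner (vjoin (- h') h) (kappa_W \<epsilon> A *v vjoin (- h') h)
      = inner h' (?P *v h') - 2 * inner h' (?P *v (A *v h)) + inner h (?P *v h)"
    unfolding kappa_W_form using kappa_P_symmetric[of "A *v h" \<epsilon> A h']
    by (simp add: matrix_vector_uminus matrix_vector_mult_diff_distrib inner_diff_left
        inner_diff_right inner_commute algebra_simps)
  have Y: "inner (vjoin (- h') h) (cmat (block Y1 0 0 Y2) *v vjoin d ?w)
      = - inner h' (?P *v h') + inner h' (?P *v (A *v h)) - (inner z z - inner (cmat D *v d) z) / \<gamma>"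
    by (simp add: cmat_block B C matrix_vector_scaleR matrix_vector_uminus matrix_vector_mult_diff_distrib
        inner_diff_left inner_diff_right)
  have Z: "inner (vjoin d ?w) (cmat (kappa_Z \<gamma> D) *v vjoin d ?w)
      = \<gamma> * (norm d)\<^sup>2 - 2 * inner (cmat D *v d) z / \<gamma> + inner z z / \<gamma>"
    unfolding cmat_kappa_Z_form using \<open>\<gamma> > 0\<close>
    by (simp add: power_mult_distrib power2_norm_eq_inner[symmetric] power2_eq_square)
  \<comment> \<open>In \<open>W + 2 Y + Z\<close> the cross terms in
    \<open>inner h' (?P *v (A *v h))\<close> and \<open>inner (cmat D *v d) z\<close>
    cancel.\<close>
  show ?thesis
    using form[of "vjoin (- h') h" "vjoin d ?w"] unfolding W Y Z
    by (simp add: power2_norm_eq_inner diff_divide_distrib)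
qed

text \<open>Strict bounds on \<open>l\<close> and \<open>D\<close> make \<open>W\<close> and
  \<open>Z\<close> invertible, so \<open>matrix_inv\<close> yields genuine right inverses; division
  by \<open>\<eta>\<close> then supplies the two contractions for
  \<open>block_form_nonneg\<close>.\<close>

lemma kappa_form_nonneg:
  fixes l :: "complex^'h" and D :: "real^'d^'z" and Yt :: "real^('d + 'z)^('h + 'h)"
  assumes "\<epsilon> > 0" and l: "\<And>j. cmod (l $ j) < 1"
    and D: "\<And>x. norm (cmat D *v x) \<le> c * norm x" and c: "0 \<le> c" "c < \<gamma>"
    and \<eta>: "\<eta> = kappa_eta (kappa_W \<epsilon> (diag l)) (kappa_Z \<gamma> D) Yt"
  shows "0 \<le> inner x (kappa_W \<epsilon> (diag l) *v x) + 2 * inner x (cmat (inverse \<eta> *\<^sub>R Yt) *v y)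
    + inner y (cmat (kappa_Z \<gamma> D) *v y)"
proof -
  let ?W = "kappa_W \<epsilon> (diag l)" and ?Z = "kappa_Z \<gamma> D" and ?Y = "inverse \<eta> *\<^sub>R Yt"
  let ?S = "matrix_inv ?W ** cmat Yt" and ?T = "cmat (matrix_inv ?Z ** transpose Yt)"
  have Wpos: "0 < inner v (?W *v v)" if "v \<noteq> 0" for v
    by (rule kappa_W_pos[OF \<open>\<epsilon> > 0\<close> l that])
  have Zpos: "0 < inner v (cmat ?Z *v v)" if "v \<noteq> 0" for v
    by (rule cmat_kappa_Z_pos[OF D c that])
  have Winv: "?W ** matrix_inv ?W = mat 1"
    by (rule matrix_inv_right_if_pos_def[OF Wpos])
  have Zinv: "?Z ** matrix_inv ?Z = mat 1"
  \<comment> \<open>This inverse is taken over the reals, so a real kernel vector is embedded by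
    \<open>cvec\<close> to contradict positivity of the complex form.\<close>
  proof (rule matrix_inv_right_if_inj)
    fix v assume "?Z *v v = 0"
    then have "cmat ?Z *v cvec v = 0" by (simp add: cmat_mult_cvec)
    then show "v = 0" using Zpos[of "cvec v"] by force
  qed
  \<comment> \<open>The entry \<open>1\<close> in the maximum makes \<open>\<eta>\<close> positive,
    so dividing by it is sound even for a zero \<open>Yt\<close>.\<close>
  have \<eta>1: "1 \<le> \<eta>" and \<eta>S: "spectral_norm ?S \<le> \<eta>" and \<eta>T: "spectral_norm ?T \<le> \<eta>"
    by (simp_all add: \<eta> kappa_eta_def)
  have scaled: "norm (inverse \<eta> *\<^sub>R (M *v v)) \<le> norm v" if "spectral_norm M \<le> \<eta>"
    for M :: "complex^'m^'n" and v
  proof -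
    have "norm (M *v v) \<le> \<eta> * norm v"
      using norm_mult_le_spectral_norm[of M v] mult_right_mono[OF that norm_ge_zero[of v]] by linarith
    then show ?thesis using \<eta>1 by (simp add: field_simps)
  qed
  show ?thesis
  proof (rule block_form_nonneg[where Y' = "(*v) (cmat (transpose ?Y))"
        and S = "\<lambda>y. inverse \<eta> *\<^sub>R (?S *v y)" and T = "\<lambda>x. inverse \<eta> *\<^sub>R (?T *v x)"])
    show "linear ((*v) ?W)" and "bounded_linear ((*v) (cmat ?Z))"
      using matrix_vector_mul_bounded_linear bounded_linear.linear by blast+
    show "0 \<le> inner x (?W *v x)" for x using Wpos[of x] by (cases "x = 0") auto
    show "0 \<le> inner y (cmat ?Z *v y)" for y using Zpos[of y] by (cases "y = 0") auto
    show "inner x (cmat ?Y *v y) = inner (cmat (transpose ?Y) *v x) y" for x y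
      by (metis cmat_transpose inner_commute inner_ctranspose)
    show "?W *v (inverse \<eta> *\<^sub>R (?S *v y)) = cmat ?Y *v y" for y
      by (simp add: matrix_vector_scaleR cmat_scaleR scaleR_matrix_vector matrix_vector_mul_assoc
          matrix_mul_assoc Winv)
    show "cmat ?Z *v (inverse \<eta> *\<^sub>R (?T *v x)) = cmat (transpose ?Y) *v x" for x
    proof -
      have "cmat ?Z *v (?T *v x) = cmat (transpose Yt) *v x"
        by (simp add: matrix_vector_mul_assoc matrix_mul_assoc cmat_mult[symmetric] Zinv)
      moreover have "transpose ?Y = inverse \<eta> *\<^sub>R transpose Yt"
        by (simp add: transpose_def vec_eq_iff)
      ultimately show ?thesis
        by (simp add: matrix_vector_scaleR cmat_scaleR scaleR_matrix_vector)
    qed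
  qed (simp_all only: kappa_W_symmetric cmat_kappa_Z_symmetric scaled \<eta>S \<eta>T)
qed

section \<open>Assembly for the parametrization\<close>

theorem theorem2:
  fixes \<gamma> \<epsilon> :: real
  assumes "\<gamma> > 0" and "\<epsilon> > 0"
  shows "free_parametrization \<gamma>
    (kappa \<gamma> \<epsilon> ::
      (real^'h) \<times> (real^'h) \<times> (real^'d^'z) \<times> (real^('d + 'z)^('h + 'h))
        \<Rightarrow> ('h::finite, 'd::finite, 'z::finite) lti)"
  unfolding free_parametrization_def
proof
  fix \<omega> :: "(real^'h) \<times> (real^'h) \<times> (real^'d^'z) \<times> (real^('d + 'z)^('h + 'h))"
  obtain \<mu> \<theta> Dt Ybar where \<omega>: "\<omega> = (\<mu>, \<theta>, Dt, Ybar)" by (rule prod_cases4)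
  define l :: "complex^'h"
    where "l = (\<chi> j. exp (- of_real (exp (\<mu> $ j)) + \<i> * of_real (exp (\<theta> $ j))))"
  define D where "D = kappa_D \<gamma> \<epsilon> Dt"
  define P where "P = kappa_P \<epsilon> (diag l)"
  define \<eta> where "\<eta> = kappa_eta (kappa_W \<epsilon> (diag l)) (kappa_Z \<gamma> D) (kappa_Yt Ybar)"
  define Y where "Y = inverse \<eta> *\<^sub>R kappa_Yt Ybar"
  define B where "B = matrix_inv P ** cmat (block11 Y)"
  have \<kappa>: "kappa \<gamma> \<epsilon> \<omega> = (diag l, B, cmat (transpose (block22 Y)), cmat D)"
    by (simp add: kappa_def \<omega> kappa_A_def Let_def l_def D_def P_def \<eta>_def Y_def B_def)
  \<comment> \<open>The modulus is the exponential of the real part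
    \<open>- exp (\<mu> $ j)\<close>, which is negative for every real parameter.\<close>
  have l: "cmod (l $ j) < 1" for j
    by (simp add: l_def norm_exp_eq_Re)
  obtain c where c: "0 \<le> c" "c < \<gamma>" "\<And>x. norm (cmat D *v x) \<le> c * norm x"
    unfolding D_def by (rule kappa_D_bound[OF assms]) blast
  \<comment> \<open>Scaling preserves the zero off-diagonal blocks created by the mask.\<close>
  have Y: "Y = block (block11 Y) 0 0 (block22 Y)"
    by (simp add: Y_def kappa_Yt_block block_def block11_def block22_def vec_eq_iff split: sum.split)
  have form: "0 \<le> inner x (kappa_W \<epsilon> (diag l) *v x) + 2 * inner x (cmat (block (block11 Y) 0 0 (block22 Y)) *v y)
      + inner y (cmat (kappa_Z \<gamma> D) *v y)" for x y
    unfolding Y[symmetric] unfolding Y_def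
    by (rule kappa_form_nonneg[OF \<open>\<epsilon> > 0\<close> l c(3,1,2) \<eta>_def])
  have PB: "P ** B = cmat (block11 Y)"
    unfolding B_def P_def matrix_mul_assoc
    by (simp add: matrix_inv_right_if_pos_def kappa_P_pos[OF \<open>\<epsilon> > 0\<close>])
  show "l2_bounded \<gamma> (kappa \<gamma> \<epsilon> \<omega>)"
  proof (rule l2_bounded_if_dissipative[OF \<open>\<gamma> > 0\<close>, where V = "\<lambda>h. inner h (P *v h)"])
    show "0 \<le> inner h (P *v h)" for h
      using \<open>\<epsilon> > 0\<close> by (simp add: P_def kappa_P_form)
    fix d :: "nat \<Rightarrow> real^'d" and k
    let ?h = "lti_state (kappa \<gamma> \<epsilon> \<omega>) d" and ?z = "lti_output (kappa \<gamma> \<epsilon> \<omega>) d k"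
    \<comment> \<open>\<open>dissipation\<close> is stated for complex inputs; the embedding
      \<open>cvec\<close> of the real input preserves norms.\<close>
    have "inner (?h (Suc k)) (P *v ?h (Suc k)) + (norm ?z)\<^sup>2 / \<gamma>
        \<le> inner (?h k) (P *v ?h k) + \<gamma> * (norm (cvec (d k)))\<^sup>2"
      unfolding P_def
      by (rule dissipation[OF \<open>\<gamma> > 0\<close> PB[unfolded P_def] form]) (simp_all only: \<kappa> lti_output_def lti_state.simps prod.case)
    then show "inner (?h (Suc k)) (P *v ?h (Suc k)) + (norm ?z)\<^sup>2 / \<gamma>
        \<le> inner (?h k) (P *v ?h k) + \<gamma> * (norm (d k))\<^sup>2" by (simp only: norm_cvec)
  qed simp
qed

end
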